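(* Let $(X,\mathcal{A})$ be a measurable space and suppose $\{\mu_\alpha\}_{\alpha\in I}$ is a collection of measures on $(X,\mathcal{A})$. Then their greatest lower bound $\bigwedge_{\alpha\in I}\mu_\alpha$ and least upper bound $\bigvee_{\alpha\in I}\mu_\alpha$ (in the poset $(\mathfrak{M}(X,\mathcal{A}),\preceq)$ of all measures on $(X,\mathcal{A})$) are given, for $A\in\mathcal{A}$, by $$\left(\bigwedge_{\alpha\in I}\mu_\alpha\right)(A)=\inf\left\{\sum_{n=1}^\infty\mu_{\alpha_n}(A\cap B_n)\right\},\qquad \left(\bigvee_{\alpha\in I}\mu_\alpha\right)(A)=\sup\left\{\sum_{n=1}^\infty\mu_{\alpha_n}(A\cap B_n)\right\},$$ where the infimum and supremum are over all pairs $(\{B_n\}_{n=1}^\infty,\{\mu_{\alpha_n}\}_{n=1}^\infty)\in\Sigma$.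
   Context: Measures are countably additive functions $\mu:\mathcal{A}\to[0,\infty]$ with $\mu(\varnothing)=0$ (the value $\infty$ is allowed). $\mathfrak{M}(X,\mathcal{A})$ denotes the poset of all measures on $(X,\mathcal{A})$, with the partial order: $\mu\preceq\nu$ if and only if $\mu(A)\le\nu(A)$ for all $A\in\mathcal{A}$. Greatest lower bounds and least upper bounds are taken with respect to $\preceq$ in $\mathfrak{M}(X,\mathcal{A})$. The index set $I$ is arbitrary (possibly uncountable). For a collection $\{\mu_\alpha\}_{\alpha\in I}$ of measures on $(X,\mathcal{A})$, $\Sigma$ denotes the set of all pairs $(\{B_n\}_{n=1}^\infty,\{\mu_{\alpha_n}\}_{n=1}^\infty)$, where $\{B_n\}_{n=1}^\infty$ is a countable collection of disjoint sets in $\mathcal{A}$ such that $\bigcup_{n=1}^\infty B_n=X$ (a countable measurable partition of $X$; some of the $B_n$ may be empty), and for each $n\in\mathbb{N}$, $\mu_{\alpha_n}$ is some measure in the collection $\{\mu_\alpha\}_{\alpha\in I}$. *)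

theory Defs
  imports "HOL-Analysis.Analysis" "HOL-Algebra.Order"
begin

text \<open>
  A value of type \<open>'a measure\<close> carries its own space and \<open>\<sigma>\<close>-algebra, and vanishes outside that
  \<open>\<sigma>\<close>-algebra. The measures on \<open>(X, \<A>)\<close> are therefore the values whose space is \<open>X\<close> and whose
  measurable sets are \<open>\<A>\<close>, and two of them are equal iff they agree on \<open>\<A>\<close>.
\<close>

definition measures_on :: "'a set \<Rightarrow> 'a set set \<Rightarrow> 'a measure set" where
  "measures_on X \<A> = {\<mu>. space \<mu> = X \<and> sets \<mu> = \<A>}"

text \<open>
  The setwise order is spelled out rather than taken from the order instance of type
  \<open>'a measure\<close>, since the latter also compares measures living on different spaces, and
  bounds are to be taken among the measures on \<open>(X, \<A>)\<close> only.
\<close>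

definition measure_poset :: "'a set \<Rightarrow> 'a set set \<Rightarrow> 'a measure gorder" where
  "measure_poset X \<A> =
    \<lparr>carrier = measures_on X \<A>, eq = (=),
     le = (\<lambda>\<mu> \<nu>. \<forall>A\<in>\<A>. emeasure \<mu> A \<le> emeasure \<nu> A)\<rparr>"

lemma partial_order_measure_poset: "partial_order (measure_poset X \<A>)"
proof unfold_locales
  fix \<mu> \<nu>
  assume "\<mu> \<sqsubseteq>\<^bsub>measure_poset X \<A>\<^esub> \<nu>" "\<nu> \<sqsubseteq>\<^bsub>measure_poset X \<A>\<^esub> \<mu>"
    "\<mu> \<in> carrier (measure_poset X \<A>)" "\<nu> \<in> carrier (measure_poset X \<A>)"
  then show "\<mu> .=\<^bsub>measure_poset X \<A>\<^esub> \<nu>"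
    by (auto simp: measure_poset_def measures_on_def intro!: measure_eqI order.antisym[where 'a=ennreal])
qed (auto simp: measure_poset_def intro: order_trans)

definition measurable_partition :: "'a set \<Rightarrow> 'a set set \<Rightarrow> (nat \<Rightarrow> 'a set) \<Rightarrow> bool" where
  "measurable_partition X \<A> B \<longleftrightarrow> range B \<subseteq> \<A> \<and> disjoint_family B \<and> (\<Union>n. B n) = X"

text \<open>
  For an empty collection there are no choices, and an infimum over them would be \<open>\<infinity>\<close> even at
  the empty set; infimum formulas over this set therefore need a nonempty \<open>C\<close>.
\<close>

definition partition_choices ::
    "'a set \<Rightarrow> 'a set set \<Rightarrow> 'a measure set \<Rightarrow> ((nat \<Rightarrow> 'a set) \<times> (nat \<Rightarrow> 'a measure)) set" where
  "partition_choices X \<A> C = {(B, \<nu>). measurable_partition X \<A> B \<and> range \<nu> \<subseteq> C}"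

end

theory Submission
  imports Defs
begin

text \<open>
  Call \<open>c = (B, \<nu>)\<close> in \<^term>\<open>partition_choices X \<A> C\<close> a choice. It pastes members of \<open>C\<close> into one
  measure \<open>A \<mapsto> \<Sum>n. \<nu>\<^sub>n(A \<inter> B\<^sub>n)\<close>, written \<open>partition_sum A c\<close>, and the claim is that the infimum
  and the supremum of these pasted measures, taken separately at each set, are the two bounds.

  That the pointwise infimum (supremum) \<open>m\<close> bounds \<open>C\<close>, and that it lies above (below) every measure
  that does, is the easy part. Each \<open>\<nu> \<in> C\<close> is itself a pasted measure (use the
  partition with \<open>X\<close> as its only nonempty part; \<open>constant_partition_choice\<close>). Conversely, if \<open>\<rho>\<close>
  is a measure below all members of \<open>C\<close>, then comparing \<open>\<rho>\<close> with \<open>\<nu>\<^sub>n\<close> on each \<open>A \<inter> B\<^sub>n\<close> and adding up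
  puts \<open>\<rho>(A)\<close> below \<open>partition_sum A c\<close>; likewise from above.

  The point is that \<open>m\<close> is countably additive, although an extremum of measures usually is not.
  For disjoint \<open>A\<^sub>i\<close>, one inequality holds because each pasted measure is countably additive
  (\<open>partition_sum_UN\<close>). The other needs that choices can be made independently on the different
  \<open>A\<^sub>i\<close>: given a choice \<open>c\<^sub>i\<close> for each \<open>i\<close>, cutting the partition of \<open>c\<^sub>i\<close> down to \<open>A\<^sub>i\<close> and collecting
  all the pieces gives a single choice which behaves like \<open>c\<^sub>i\<close> on \<open>A\<^sub>i\<close>
  (\<open>partition_sum_glue_disjoint\<close>). Hence optimizing each summand on its own gains nothing over
  optimizing the whole sum; \<open>suminf_SUP_leI\<close> and \<open>suminf_INF_geI\<close> turn this into an inequality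
  for the sum of the extrema.
\<close>

section \<open>Interchanging series with suprema and infima\<close>

lemma ennreal_suminf_commute:
  fixes f :: "nat \<Rightarrow> nat \<Rightarrow> ennreal"
  shows "(\<Sum>i. \<Sum>j. f i j) = (\<Sum>j. \<Sum>i. f i j)"
  using nn_integral_suminf[of "\<lambda>j i. f i j" "count_space UNIV"]
  by (simp add: nn_integral_count_space_nat)

text \<open>
  The suprema need not be attained, but each is the limit of an increasing sequence of values, so
  monotone convergence bounds the series of suprema by series of values actually taken. The
  elements \<open>s i\<close> are chosen independently of each other.
\<close>

lemma suminf_SUP_leI:
  fixes f :: "nat \<Rightarrow> 'c \<Rightarrow> ennreal"
  assumes "S \<noteq> {}"
    and bound: "\<And>s. (\<And>i. s i \<in> S) \<Longrightarrow> (\<Sum>i. f i (s i)) \<le> b"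
  shows "(\<Sum>i. SUP x\<in>S. f i x) \<le> b"
proof -
  have "\<forall>i. \<exists>g::nat \<Rightarrow> ennreal. incseq g \<and> range g \<subseteq> f i ` S \<and> (SUP x\<in>S. f i x) = (SUP k. g k)"
    using ennreal_Sup_countable_SUP \<open>S \<noteq> {}\<close> by (metis image_is_empty)
  then obtain g where g: "\<And>i. incseq (g i)" "\<And>i. range (g i) \<subseteq> f i ` S"
      "\<And>i. (SUP x\<in>S. f i x) = (SUP k. g i k)"
    by metis
  have "\<forall>i k. \<exists>x\<in>S. g i k = f i x"
    using g(2) by fast
  then obtain s where s: "\<And>i k. s i k \<in> S" "\<And>i k. g i k = f i (s i k)"
    by metis
  have "(\<Sum>i. SUP x\<in>S. f i x) = (SUP k. \<Sum>i. g i k)"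
    unfolding g(3) using g(1) by (intro ennreal_suminf_SUP_eq)
  also have "\<dots> \<le> b"
    unfolding s(2) using s(1) by (intro SUP_least bound)
  finally show ?thesis .
qed

text \<open>
  Monotone convergence fails for decreasing sequences with infinite sums. Instead, when the series
  of infima is finite, so is each infimum, and the \<open>i\<close>-th one can be approximated within
  \<open>e / 2^(i + 1)\<close>, for a total error of \<open>e\<close>.
\<close>

lemma suminf_INF_geI:
  fixes f :: "nat \<Rightarrow> 'c \<Rightarrow> ennreal"
  assumes bound: "\<And>s. (\<And>i. s i \<in> S) \<Longrightarrow> b \<le> (\<Sum>i. f i (s i))"
  shows "b \<le> (\<Sum>i. INF x\<in>S. f i x)"
proof (rule ennreal_le_epsilon)
  let ?m = "\<lambda>i. INF x\<in>S. f i x"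
  fix e :: real
  assume fin: "suminf ?m < Orderings.top" and "0 < e"
  have "\<exists>x\<in>S. f i x < ?m i + ennreal (e * (1/2) ^ Suc i)" for i
  proof (rule INF_approx_ennreal)
    show "?m i \<noteq> \<infinity>"
      using ennreal_suminf_lessD[OF fin, of i] unfolding infinity_ennreal_def by (rule less_imp_neq)
  qed (use \<open>0 < e\<close> in auto)
  then obtain s where s: "\<And>i. s i \<in> S" "\<And>i. f i (s i) < ?m i + ennreal (e * (1/2) ^ Suc i)"
    by metis
  have "b \<le> (\<Sum>i. f i (s i))"
    by (rule bound) (rule s)
  also have "\<dots> \<le> (\<Sum>i. ?m i + ennreal (e * (1/2) ^ Suc i))"
    using s(2) by (intro suminf_le less_imp_le) auto
  also have "\<dots> = suminf ?m + (\<Sum>i. ennreal (e * (1/2) ^ Suc i))"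
    by (rule suminf_add[symmetric]) auto
  also have "(\<Sum>i. ennreal (e * (1/2) ^ Suc i)) = ennreal e"
    using sums_mult[OF power_half_series, of e] \<open>0 < e\<close> by (intro suminf_ennreal_eq) auto
  finally show "b \<le> suminf ?m + ennreal e" .
qed

section \<open>Pasting measures along a partition\<close>

definition partition_sum :: "'a set \<Rightarrow> (nat \<Rightarrow> 'a set) \<times> (nat \<Rightarrow> 'a measure) \<Rightarrow> ennreal" where
  "partition_sum A = (\<lambda>(B, \<nu>). \<Sum>n. emeasure (\<nu> n) (A \<inter> B n))"

lemma partition_sum_UN:
  assumes "sigma_algebra X \<A>"
    and C: "C \<subseteq> measures_on X \<A>" and c: "c \<in> partition_choices X \<A> C"
    and A: "range A \<subseteq> \<A>" "disjoint_family A"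
  shows "partition_sum (\<Union>i. A i) c = (\<Sum>i. partition_sum (A i) c)"
proof -
  interpret sigma_algebra X \<A> by fact
  obtain B \<nu> where Bv: "c = (B, \<nu>)" "range B \<subseteq> \<A>" "\<And>n. sets (\<nu> n) = \<A>"
    using C c by (cases c) (auto simp: partition_choices_def measurable_partition_def measures_on_def
        subset_iff image_iff)
  have "emeasure (\<nu> n) ((\<Union>i. A i) \<inter> B n) = (\<Sum>i. emeasure (\<nu> n) (A i \<inter> B n))" for n
  proof -
    have "range (\<lambda>i. A i \<inter> B n) \<subseteq> sets (\<nu> n)"
      unfolding Bv(3) using Bv(2) A(1) by (auto intro!: Int)
    moreover have "disjoint_family (\<lambda>i. A i \<inter> B n)"
      using A(2) by (auto simp: disjoint_family_on_def)
    ultimately show ?thesis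
      by (simp add: suminf_emeasure)
  qed
  then show ?thesis
    by (simp add: Bv(1) partition_sum_def ennreal_suminf_commute[of "\<lambda>n i. emeasure (\<nu> n) (A i \<inter> B n)"])
qed

text \<open>
  Let \<open>B\<^sub>i\<^sub>n\<close> be the \<open>n\<close>-th part of the partition of \<open>c i\<close>. The sets \<open>P i \<inter> B\<^sub>i\<^sub>n\<close> form a partition
  indexed by the pairs \<open>(i, n)\<close>, which are enumerated by
  \<^const>\<open>prod_decode\<close>; the part \<open>P i \<inter> B\<^sub>i\<^sub>n\<close> keeps the measure that \<open>c i\<close> assigns to \<open>B\<^sub>i\<^sub>n\<close>. As terms
  of a series in \<^typ>\<open>ennreal\<close> may be summed in any order, the double series can be evaluated one
  \<open>i\<close> at a time.
\<close>

lemma partition_sum_glue: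
  assumes "sigma_algebra X \<A>" and P: "measurable_partition X \<A> P"
    and c: "\<And>i. c i \<in> partition_choices X \<A> C"
  obtains d where "d \<in> partition_choices X \<A> C"
    "\<forall>A. partition_sum A d = (\<Sum>i. partition_sum (A \<inter> P i) (c i))"
proof -
  interpret sigma_algebra X \<A> by fact
  define Q where "Q = (\<lambda>k. case prod_decode k of (i, n) \<Rightarrow> P i \<inter> fst (c i) n)"
  define \<nu> where "\<nu> = (\<lambda>k. case prod_decode k of (i, n) \<Rightarrow> snd (c i) n)"
  have B: "measurable_partition X \<A> (fst (c i))" and v: "range (snd (c i)) \<subseteq> C" for i
    using c[of i] by (auto simp: partition_choices_def)
  have cover: "(\<Union>n. fst (c i) n) = X" for i
    using B[of i] by (simp add: measurable_partition_def)
  have "measurable_partition X \<A> Q"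
    unfolding measurable_partition_def
  proof (intro conjI)
    show "range Q \<subseteq> \<A>"
    proof (rule image_subsetI)
      fix k
      obtain i n where "prod_decode k = (i, n)"
        by fastforce
      moreover have "P i \<in> \<A>" "fst (c i) n \<in> \<A>"
        using P B[of i] by (auto simp: measurable_partition_def)
      ultimately show "Q k \<in> \<A>"
        by (simp add: Q_def Int)
    qed
    show "disjoint_family Q"
      unfolding disjoint_family_on_def
    proof (intro ballI impI)
      fix k l :: nat
      assume "k \<noteq> l"
      obtain i n j m where kl: "prod_decode k = (i, n)" "prod_decode l = (j, m)"
        by fastforce
      with \<open>k \<noteq> l\<close> have "i \<noteq> j \<or> i = j \<and> n \<noteq> m"
        by (metis prod_decode_inverse)
      moreover have "P i \<inter> P j = {}" if "i \<noteq> j"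
        using P that by (auto simp: measurable_partition_def disjoint_family_on_def)
      moreover have "fst (c i) n \<inter> fst (c i) m = {}" if "n \<noteq> m"
        using B[of i] that by (auto simp: measurable_partition_def disjoint_family_on_def)
      ultimately show "Q k \<inter> Q l = {}"
        by (auto simp: Q_def kl)
    qed
    have "(\<Union>k. Q k) = (\<Union>i. \<Union>n. P i \<inter> fst (c i) n)"
    proof (intro equalityI UN_least)
      show "Q k \<subseteq> (\<Union>i. \<Union>n. P i \<inter> fst (c i) n)" for k
        by (auto simp: Q_def split: prod.splits)
      have "Q (prod_encode (i, n)) = P i \<inter> fst (c i) n" for i n
        by (simp add: Q_def)
      then show "P i \<inter> fst (c i) n \<subseteq> (\<Union>k. Q k)" for i n
        by blast
    qed
    also have "\<dots> = (\<Union>i. P i \<inter> X)"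
      by (simp add: cover)
    finally show "(\<Union>k. Q k) = X"
      using P by (auto simp: measurable_partition_def)
  qed
  moreover have "range \<nu> \<subseteq> C"
    using v by (fastforce simp: \<nu>_def split: prod.splits)
  ultimately have "(Q, \<nu>) \<in> partition_choices X \<A> C"
    by (simp add: partition_choices_def)
  moreover have "partition_sum A (Q, \<nu>) = (\<Sum>i. partition_sum (A \<inter> P i) (c i))" for A
  proof -
    have "(\<Sum>k. (\<lambda>(i, n). emeasure (snd (c i) n) (A \<inter> P i \<inter> fst (c i) n)) (prod_decode k))
      = (\<Sum>i. partition_sum (A \<inter> P i) (c i))"
      by (rule suminf_ennreal_2dimen) (simp add: partition_sum_def case_prod_unfold)
    then show ?thesis
      by (simp add: partition_sum_def Q_def \<nu>_def case_prod_unfold Int_assoc)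
  qed
  ultimately show thesis
    by (intro that) auto
qed

lemma partition_sum_glue_disjoint:
  assumes "sigma_algebra X \<A>" and A: "range A \<subseteq> \<A>" "disjoint_family A"
    and c: "\<And>i. c i \<in> partition_choices X \<A> C"
  obtains d where "d \<in> partition_choices X \<A> C"
    "partition_sum (\<Union>i. A i) d = (\<Sum>i. partition_sum (A i) (c i))"
proof -
  interpret sigma_algebra X \<A> by fact
  \<comment> \<open>The sets \<open>A i\<close> need not cover \<open>X\<close>. What remains can be added to any of them, since it does not
    meet the union on which the sum is evaluated.\<close>
  define P where "P = (\<lambda>i. if i = 0 then A 0 \<union> (X - (\<Union>i. A i)) else A i)"
  have "A i \<subseteq> X" for i
    using A(1) sets_into_space by blast
  moreover have "range P \<subseteq> \<A>"
    using A(1) by (auto simp: P_def)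
  moreover have "disjoint_family P"
    using A(2) by (auto simp: P_def disjoint_family_on_def)
  moreover have "(\<Union>i. P i) = (\<Union>i. A i) \<union> (X - (\<Union>i. A i))"
  proof (rule equalityI)
    have "A i \<subseteq> P i" for i
      by (simp add: P_def)
    moreover have "X - (\<Union>i. A i) \<subseteq> P 0"
      by (simp add: P_def)
    ultimately show "(\<Union>i. A i) \<union> (X - (\<Union>i. A i)) \<subseteq> (\<Union>i. P i)"
      by blast
  qed (auto simp: P_def split: if_splits)
  ultimately have "measurable_partition X \<A> P"
    by (auto simp: measurable_partition_def)
  then obtain d where d: "d \<in> partition_choices X \<A> C"
      "\<forall>E. partition_sum E d = (\<Sum>i. partition_sum (E \<inter> P i) (c i))"
    by (rule partition_sum_glue[where c = c, OF assms(1) _ c])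
  have "(\<Union>i. A i) \<inter> P i = A i" for i
    using A(2) by (auto simp: P_def disjoint_family_on_def)
  with d show thesis
    by (intro that[of d]) simp_all
qed

text \<open>
  Each member of \<open>C\<close> is thus one of the pasted measures, which makes the infimum and the supremum of
  the pasted measures bounds for \<open>C\<close>.
\<close>

lemma constant_partition_choice:
  assumes "sigma_algebra X \<A>" "\<nu> \<in> C" "\<nu> \<in> measures_on X \<A>"
  obtains c where "c \<in> partition_choices X \<A> C"
    "\<And>A. A \<in> \<A> \<Longrightarrow> partition_sum A c = emeasure \<nu> A"
proof
  interpret sigma_algebra X \<A> by fact
  let ?B = "\<lambda>n::nat. if n = 0 then X else {}"
  show "(?B, \<lambda>n. \<nu>) \<in> partition_choices X \<A> C"
    using assms(2) by (auto simp: partition_choices_def measurable_partition_def disjoint_family_on_def)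
  fix A assume "A \<in> \<A>"
  then have "A \<inter> X = A"
    using sets_into_space by blast
  moreover have "(\<Sum>n. emeasure \<nu> (A \<inter> ?B n)) = (\<Sum>n\<in>{0}. emeasure \<nu> (A \<inter> ?B n))"
    by (rule suminf_finite) auto
  ultimately show "partition_sum A (?B, \<lambda>n. \<nu>) = emeasure \<nu> A"
    by (simp add: partition_sum_def)
qed

text \<open>
  This allows a measure \<open>\<rho>\<close> that bounds \<open>C\<close> to be compared with a pasted measure part by part, and
  so makes the infimum and the supremum of the pasted measures the best bounds.
\<close>

lemma suminf_emeasure_partition:
  assumes "sigma_algebra X \<A>" "\<rho> \<in> measures_on X \<A>" "measurable_partition X \<A> B" "A \<in> \<A>"
  shows "(\<Sum>n. emeasure \<rho> (A \<inter> B n)) = emeasure \<rho> A"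
proof -
  interpret sigma_algebra X \<A> by fact
  have "(\<Sum>n. emeasure \<rho> (A \<inter> B n)) = emeasure \<rho> (\<Union>n. A \<inter> B n)"
    using assms by (intro suminf_emeasure)
      (auto simp: measures_on_def measurable_partition_def disjoint_family_on_def)
  also have "(\<Union>n. A \<inter> B n) = A"
    using assms(3) sets_into_space[OF \<open>A \<in> \<A>\<close>] by (auto simp: measurable_partition_def)
  finally show ?thesis .
qed

section \<open>The two bounds\<close>

lemma measure_with_values:
  assumes "sigma_algebra X \<A>" "m {} = 0"
    and "\<And>A. range A \<subseteq> \<A> \<Longrightarrow> disjoint_family A \<Longrightarrow> (\<Sum>i. m (A i)) = m (\<Union>i. A i)"
  obtains \<kappa> where "\<kappa> \<in> measures_on X \<A>" "\<And>A. A \<in> \<A> \<Longrightarrow> emeasure \<kappa> A = m A"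
proof
  interpret sigma_algebra X \<A> by fact
  show "measure_of X \<A> m \<in> measures_on X \<A>"
    using space_closed by (simp add: measures_on_def sigma_sets_eq)
  show "emeasure (measure_of X \<A> m) A = m A" if "A \<in> \<A>" for A
    using assms that by (intro emeasure_measure_of_sigma)
      (auto simp: positive_def countably_additive_def)
qed

text \<open>
  A nonempty \<open>C\<close> provides a choice, so the infimum at the empty set is \<open>0\<close> rather than \<open>\<infinity>\<close>.
\<close>

lemma glb_measure_poset:
  assumes "sigma_algebra X \<A>" "C \<subseteq> measures_on X \<A>" "C \<noteq> {}"
  obtains \<kappa> where "is_glb (measure_poset X \<A>) \<kappa> C"
    "\<And>A. A \<in> \<A> \<Longrightarrow> emeasure \<kappa> A = (INF c\<in>partition_choices X \<A> C. partition_sum A c)"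
proof -
  interpret sigma_algebra X \<A> by fact
  define S where "S = partition_choices X \<A> C"
  define m where "m A = (INF c\<in>S. partition_sum A c)" for A
  have le: "m A \<le> emeasure \<nu> A" if "\<nu> \<in> C" "A \<in> \<A>" for A \<nu>
    using constant_partition_choice[OF assms(1) that(1)] assms(2) that
    unfolding m_def S_def by (metis INF_lower subsetD)
  have "m {} = 0"
    using le[of _ "{}"] \<open>C \<noteq> {}\<close> by fastforce
  moreover have "(\<Sum>i. m (A i)) = m (\<Union>i. A i)" if A: "range A \<subseteq> \<A>" "disjoint_family A" for A
  proof (rule antisym)
    show "(\<Sum>i. m (A i)) \<le> m (\<Union>i. A i)"
      unfolding m_def
      by (rule INF_greatest)
        (auto simp: partition_sum_UN[OF assms(1,2) _ A] S_def intro!: suminf_le INF_lower)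
    show "m (\<Union>i. A i) \<le> (\<Sum>i. m (A i))"
      unfolding m_def
    proof (rule suminf_INF_geI)
      fix s :: "nat \<Rightarrow> (nat \<Rightarrow> 'a set) \<times> (nat \<Rightarrow> 'a measure)"
      assume "\<And>i. s i \<in> S"
      then obtain d where "d \<in> S" "partition_sum (\<Union>i. A i) d = (\<Sum>i. partition_sum (A i) (s i))"
        unfolding S_def by (rule partition_sum_glue_disjoint[OF assms(1) A])
      then show "(INF c\<in>S. partition_sum (\<Union>i. A i) c) \<le> (\<Sum>i. partition_sum (A i) (s i))"
        by (metis INF_lower)
    qed
  qed
  ultimately obtain \<kappa> where \<kappa>: "\<kappa> \<in> measures_on X \<A>" "\<And>A. A \<in> \<A> \<Longrightarrow> emeasure \<kappa> A = m A"
    using measure_with_values[OF assms(1)] by metis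
  have "emeasure \<rho> A \<le> m A"
    if \<rho>: "\<rho> \<in> measures_on X \<A>" "\<And>\<nu> E. \<nu> \<in> C \<Longrightarrow> E \<in> \<A> \<Longrightarrow> emeasure \<rho> E \<le> emeasure \<nu> E"
      and A: "A \<in> \<A>" for \<rho> A
    unfolding m_def
  proof (intro INF_greatest)
    fix c assume "c \<in> S"
    then obtain B \<nu> where c: "c = (B, \<nu>)" "measurable_partition X \<A> B" "\<And>n. \<nu> n \<in> C"
      by (auto simp: S_def partition_choices_def image_subset_iff)
    have "emeasure \<rho> A = (\<Sum>n. emeasure \<rho> (A \<inter> B n))"
      using suminf_emeasure_partition[OF assms(1) \<rho>(1) c(2) A] by simp
    also have "\<dots> \<le> (\<Sum>n. emeasure (\<nu> n) (A \<inter> B n))"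
      using c A by (intro suminf_le \<rho>) (auto simp: measurable_partition_def intro!: Int)
    finally show "emeasure \<rho> A \<le> partition_sum A c"
      by (simp add: partition_sum_def c)
  qed
  then have "is_glb (measure_poset X \<A>) \<kappa> C"
    using \<kappa> le assms(2) by (auto simp: greatest_def Lower_def measure_poset_def subset_iff)
  then show thesis
    using that \<kappa>(2) unfolding m_def S_def by blast
qed

text \<open>
  Without any measure in \<open>C\<close> there is no choice, and the supremum over the empty set is \<open>0\<close>: the
  zero measure, which is the least element of the poset and hence the least upper bound of \<open>{}\<close>.
\<close>

lemma lub_measure_poset:
  assumes "sigma_algebra X \<A>" "C \<subseteq> measures_on X \<A>"
  obtains \<kappa> where "is_lub (measure_poset X \<A>) \<kappa> C"
    "\<And>A. A \<in> \<A> \<Longrightarrow> emeasure \<kappa> A = (SUP c\<in>partition_choices X \<A> C. partition_sum A c)"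
proof -
  interpret sigma_algebra X \<A> by fact
  define S where "S = partition_choices X \<A> C"
  define m where "m A = (SUP c\<in>S. partition_sum A c)" for A
  have ge: "emeasure \<nu> A \<le> m A" if "\<nu> \<in> C" "A \<in> \<A>" for A \<nu>
    using constant_partition_choice[OF assms(1) that(1)] assms(2) that
    unfolding m_def S_def by (metis SUP_upper subsetD)
  have least: "m A \<le> emeasure \<rho> A"
    if \<rho>: "\<rho> \<in> measures_on X \<A>" "\<And>\<nu> E. \<nu> \<in> C \<Longrightarrow> E \<in> \<A> \<Longrightarrow> emeasure \<nu> E \<le> emeasure \<rho> E"
      and A: "A \<in> \<A>" for \<rho> A
    unfolding m_def
  proof (intro SUP_least)
    fix c assume "c \<in> S"
    then obtain B \<nu> where c: "c = (B, \<nu>)" "measurable_partition X \<A> B" "\<And>n. \<nu> n \<in> C"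
      by (auto simp: S_def partition_choices_def image_subset_iff)
    have "(\<Sum>n. emeasure (\<nu> n) (A \<inter> B n)) \<le> (\<Sum>n. emeasure \<rho> (A \<inter> B n))"
      using c A by (intro suminf_le \<rho>) (auto simp: measurable_partition_def intro!: Int)
    also have "\<dots> = emeasure \<rho> A"
      using suminf_emeasure_partition[OF assms(1) \<rho>(1) c(2) A] by simp
    finally show "partition_sum A c \<le> emeasure \<rho> A"
      by (simp add: partition_sum_def c)
  qed
  have "m {} = 0"
    by (auto simp: m_def partition_sum_def SUP_eq_iff bot_ennreal intro!: antisym SUP_least)
  moreover have "(\<Sum>i. m (A i)) = m (\<Union>i. A i)" if A: "range A \<subseteq> \<A>" "disjoint_family A" for A
  proof (rule antisym)
    show "m (\<Union>i. A i) \<le> (\<Sum>i. m (A i))"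
      unfolding m_def
      by (rule SUP_least)
        (auto simp: partition_sum_UN[OF assms(1,2) _ A] S_def intro!: suminf_le SUP_upper)
    show "(\<Sum>i. m (A i)) \<le> m (\<Union>i. A i)"
    proof (cases "S = {}")
      case True
      then show ?thesis
        by (simp add: m_def bot_ennreal)
    next
      case False
      then show ?thesis
        unfolding m_def
      proof (rule suminf_SUP_leI)
        fix s :: "nat \<Rightarrow> (nat \<Rightarrow> 'a set) \<times> (nat \<Rightarrow> 'a measure)"
        assume "\<And>i. s i \<in> S"
        then obtain d where "d \<in> S" "partition_sum (\<Union>i. A i) d = (\<Sum>i. partition_sum (A i) (s i))"
          unfolding S_def by (rule partition_sum_glue_disjoint[OF assms(1) A])
        then show "(\<Sum>i. partition_sum (A i) (s i)) \<le> (SUP c\<in>S. partition_sum (\<Union>i. A i) c)"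
          by (metis SUP_upper)
      qed
    qed
  qed
  ultimately obtain \<kappa> where \<kappa>: "\<kappa> \<in> measures_on X \<A>" "\<And>A. A \<in> \<A> \<Longrightarrow> emeasure \<kappa> A = m A"
    using measure_with_values[OF assms(1)] by metis
  have "is_lub (measure_poset X \<A>) \<kappa> C"
    using \<kappa> ge least assms(2) by (auto simp: least_def Upper_def measure_poset_def subset_iff)
  then show thesis
    using that \<kappa>(2) unfolding m_def S_def by blast
qed

theorem theorem4:
  fixes X :: "'a set" and \<A> :: "'a set set"
    and I :: "'i set" and \<mu> :: "'i \<Rightarrow> 'a measure"
  assumes "sigma_algebra X \<A>"
    and "\<And>\<alpha>. \<alpha> \<in> I \<Longrightarrow> \<mu> \<alpha> \<in> measures_on X \<A>"
  shows "(I \<noteq> {} \<longrightarrow> (\<exists>\<kappa>. is_glb (measure_poset X \<A>) \<kappa> (\<mu> ` I) \<and>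
           (\<forall>A\<in>\<A>. emeasure \<kappa> A =
              (INF (B, \<nu>) \<in> partition_choices X \<A> (\<mu> ` I). \<Sum>n. emeasure (\<nu> n) (A \<inter> B n)))))
       \<and> (\<exists>\<kappa>. is_lub (measure_poset X \<A>) \<kappa> (\<mu> ` I) \<and>
           (\<forall>A\<in>\<A>. emeasure \<kappa> A =
              (SUP (B, \<nu>) \<in> partition_choices X \<A> (\<mu> ` I). \<Sum>n. emeasure (\<nu> n) (A \<inter> B n))))"
proof -
  have C: "\<mu> ` I \<subseteq> measures_on X \<A>"
    using assms(2) by blast
  show ?thesis
  proof (intro conjI impI)
    assume "I \<noteq> {}"
    then obtain \<kappa> where "is_glb (measure_poset X \<A>) \<kappa> (\<mu> ` I)"
      "\<And>A. A \<in> \<A> \<Longrightarrow>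
        emeasure \<kappa> A = (INF c\<in>partition_choices X \<A> (\<mu> ` I). partition_sum A c)"
      using glb_measure_poset[OF assms(1) C] by blast
    then show "\<exists>\<kappa>. is_glb (measure_poset X \<A>) \<kappa> (\<mu> ` I) \<and>
        (\<forall>A\<in>\<A>. emeasure \<kappa> A =
          (INF (B, \<nu>) \<in> partition_choices X \<A> (\<mu> ` I). \<Sum>n. emeasure (\<nu> n) (A \<inter> B n)))"
      unfolding partition_sum_def by blast
  next
    obtain \<kappa> where "is_lub (measure_poset X \<A>) \<kappa> (\<mu> ` I)"
      "\<And>A. A \<in> \<A> \<Longrightarrow>
        emeasure \<kappa> A = (SUP c\<in>partition_choices X \<A> (\<mu> ` I). partition_sum A c)"
      using lub_measure_poset[OF assms(1) C] by blast
    then show "\<exists>\<kappa>. is_lub (measure_poset X \<A>) \<kappa> (\<mu> ` I) \<and>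
        (\<forall>A\<in>\<A>. emeasure \<kappa> A =
          (SUP (B, \<nu>) \<in> partition_choices X \<A> (\<mu> ` I). \<Sum>n. emeasure (\<nu> n) (A \<inter> B n)))"
      unfolding partition_sum_def by blast
  qed
qed

end
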